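(* Let $\langle A\rangle$ be a GCNS numerical semigroup and let $p$ be a positive divisor of $a$ with $p\neq a$. If $ua+d+k-2\geq\sum_{i=1}^{k-1}s_i$, then $$g\left(\frac{\langle A\rangle}{p}\right)=\sum_{r=1}^{\frac{a}{p}-1}\left(\sum_{i=1}^k x_i\right)_{rp}+\frac{ua+d-1}{2}\left(\frac{a}{p}-1\right),$$ where $\left(\sum_{i=1}^k x_i\right)_{rp}$ denotes the sum of the entries of the greedy presentation $X(rp)=(x_1,\ldots,x_k)$ of $rp$, with $x_k=\lfloor \frac{rp}{b_k}\rfloor$.
   Context: A GCNS numerical semigroup is $\langle A\rangle$ with $A=(a,h_1a+db_1,\ldots,h_ka+db_k)$, where $a,k\geq 2$, $d\in\mathbb{Z}\setminus\{0\}$, $\gcd(a,d)=1$, $b_1=1$, $b_{i+1}=s_ib_i+1$ with $1\leq s_1\leq s_2\leq\cdots\leq s_{k-1}$, $h_i=ub_i+1$ with $u\in\mathbb{Z}^+$, and additionally $h_ia+db_i>1$ for all $i$ when $d<0$. For $p\in\mathbb{Z}^+$, $\frac{\langle A\rangle}{p}=\{x\in\mathbb{N}\mid px\in\langle A\rangle\}$, and $g(S)$ denotes the genus (number of positive integers not in $S$). The greedy presentation $X(M)=(x_1,\ldots,x_k)$ of $M\in\mathbb{N}$ is the unique solution in $\mathbb{N}^k$ of $\sum_i b_ix_i=M$ with $x_k=\lfloor M/b_k\rfloor$, $x_i\in\{0,1,\ldots,s_i\}$ for $1\leq i\leq k-1$, and such that if $x_i=s_i$ for some $2\leq i\leq k-1$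 then $x_1=\cdots=x_{i-1}=0$. *)

theory Defs
  imports Complex_Main
begin

definition generated_semigroup :: "int list \<Rightarrow> nat set" where
  "generated_semigroup A =
     {n. \<exists>c :: nat \<Rightarrow> nat. int n = (\<Sum>i<length A. int (c i) * A ! i)}"

definition semigroup_quotient :: "nat set \<Rightarrow> nat \<Rightarrow> nat set" where
  "semigroup_quotient S p = {x. p * x \<in> S}"

definition genus :: "nat set \<Rightarrow> nat" where
  "genus S = card {n. 0 < n \<and> n \<notin> S}"

text \<open>All sequences are indexed from 1; the value of \<open>gcns_b\<close> at 0 is a dummy.\<close>

fun gcns_b :: "(nat \<Rightarrow> nat) \<Rightarrow> nat \<Rightarrow> nat" where
  "gcns_b s 0 = 0"
| "gcns_b s (Suc 0) = 1"
| "gcns_b s (Suc (Suc i)) = s (Suc i) * gcns_b s (Suc i) + 1"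

definition gcns_h :: "nat \<Rightarrow> (nat \<Rightarrow> nat) \<Rightarrow> nat \<Rightarrow> nat" where
  "gcns_h u s i = u * gcns_b s i + 1"

definition gcns_gen :: "nat \<Rightarrow> int \<Rightarrow> nat \<Rightarrow> (nat \<Rightarrow> nat) \<Rightarrow> nat \<Rightarrow> int" where
  "gcns_gen a d u s i = int (gcns_h u s i) * int a + d * int (gcns_b s i)"

definition gcns_tuple :: "nat \<Rightarrow> nat \<Rightarrow> int \<Rightarrow> nat \<Rightarrow> (nat \<Rightarrow> nat) \<Rightarrow> int list" where
  "gcns_tuple a k d u s = int a # map (gcns_gen a d u s) [1..<Suc k]"

definition is_gcns :: "nat \<Rightarrow> nat \<Rightarrow> int \<Rightarrow> nat \<Rightarrow> (nat \<Rightarrow> nat) \<Rightarrow> bool" where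
  "is_gcns a k d u s \<longleftrightarrow>
     a \<ge> 2 \<and> k \<ge> 2 \<and> d \<noteq> 0 \<and> gcd (int a) d = 1 \<and> u > 0 \<and>
     1 \<le> s 1 \<and> (\<forall>i\<in>{1..<k - 1}. s i \<le> s (i + 1)) \<and>
     (d < 0 \<longrightarrow> (\<forall>i\<in>{1..k}. gcns_gen a d u s i > 1))"

text \<open>A tuple \<open>(x\<^sub>1, \<dots>, x\<^sub>k)\<close> is encoded as a function vanishing outside \<open>{1..k}\<close>.\<close>

definition is_greedy_presentation ::
    "(nat \<Rightarrow> nat) \<Rightarrow> nat \<Rightarrow> nat \<Rightarrow> (nat \<Rightarrow> nat) \<Rightarrow> bool" where
  "is_greedy_presentation s k M x \<longleftrightarrow>
     (\<forall>i. i \<notin> {1..k} \<longrightarrow> x i = 0) \<and>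
     (\<Sum>i=1..k. gcns_b s i * x i) = M \<and>
     x k = M div gcns_b s k \<and>
     (\<forall>i\<in>{1..k - 1}. x i \<le> s i) \<and>
     (\<forall>i\<in>{2..k - 1}. x i = s i \<longrightarrow> (\<forall>j\<in>{1..<i}. x j = 0))"

definition greedy_presentation :: "(nat \<Rightarrow> nat) \<Rightarrow> nat \<Rightarrow> nat \<Rightarrow> nat \<Rightarrow> nat" where
  "greedy_presentation s k M = (THE x. is_greedy_presentation s k M x)"

lemma gcns_b_pos: "1 \<le> i \<Longrightarrow> 0 < gcns_b s i"
  by (induction s i rule: gcns_b.induct) auto

lemma gcns_b_Suc: "1 \<le> i \<Longrightarrow> gcns_b s (Suc i) = s i * gcns_b s i + 1"
  by (cases i) auto

lemma greedy_partial_sum_less: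
  assumes "1 \<le> n"
    and "\<forall>i\<in>{1..<n}. x i \<le> s i"
    and "\<forall>i\<in>{1..<n}. x i = s i \<longrightarrow> (\<forall>j\<in>{1..<i}. x j = 0)"
  shows "(\<Sum>i=1..<n. gcns_b s i * x i) < gcns_b s n"
  using assms
proof (induction n rule: nat_induct_at_least)
  case base
  then show ?case by simp
next
  case (Suc n)
  let ?S = "\<Sum>i=1..<n. gcns_b s i * x i"
  have sub: "{1..<n} \<subseteq> {1..<Suc n}" by auto
  have IH: "?S < gcns_b s n" using Suc.prems sub by (intro Suc.IH) blast+
  have le: "x n \<le> s n" using Suc.hyps Suc.prems(1) by simp
  have "gcns_b s n * x n + ?S \<le> s n * gcns_b s n"
  proof (cases "x n = s n")
    case True
    have "n \<in> {1..<Suc n}" using Suc.hyps by simp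
    then have "\<forall>j\<in>{1..<n}. x j = 0" using Suc.prems(2) True by blast
    then have "?S = 0" by simp
    then show ?thesis using True by simp
  next
    case False
    then have "Suc (x n) \<le> s n" using le by simp
    then have "Suc (x n) * gcns_b s n \<le> s n * gcns_b s n" by (rule mult_le_mono1)
    then show ?thesis using IH by (simp add: algebra_simps)
  qed
  then show ?case using Suc.hyps by (simp add: gcns_b_Suc)
qed

lemma greedy_partial_exists:
  assumes "1 \<le> n" and "R < gcns_b s n"
  shows "\<exists>x. (\<forall>i. i \<notin> {1..<n} \<longrightarrow> x i = 0) \<and> (\<Sum>i=1..<n. gcns_b s i * x i) = R \<and>
    (\<forall>i\<in>{1..<n}. x i \<le> s i) \<and>
    (\<forall>i\<in>{1..<n}. x i = s i \<longrightarrow> (\<forall>j\<in>{1..<i}. x j = 0))"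
  using assms
proof (induction n arbitrary: R rule: nat_induct_at_least)
  case base
  then show ?case by (intro exI[of _ "\<lambda>_. 0"]) simp
next
  case (Suc n)
  let ?b = "gcns_b s n"
  have bpos: "0 < ?b" using gcns_b_pos Suc.hyps by blast
  obtain x where x0: "\<forall>i. i \<notin> {1..<n} \<longrightarrow> x i = 0"
    and xs: "(\<Sum>i=1..<n. gcns_b s i * x i) = R mod ?b"
    and xle: "\<forall>i\<in>{1..<n}. x i \<le> s i"
    and xg: "\<forall>i\<in>{1..<n}. x i = s i \<longrightarrow> (\<forall>j\<in>{1..<i}. x j = 0)"
    using Suc.IH[of "R mod ?b"] bpos by auto
  define y where "y = x(n := R div ?b)"
  have R: "R \<le> s n * ?b" using Suc by (simp add: gcns_b_Suc)
  have yle: "R div ?b \<le> s n"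
    using div_le_mono[OF R, of ?b] bpos by simp
  have yz: "\<forall>j\<in>{1..<n}. x j = 0" if "R div ?b = s n"
  proof -
    have "R mod ?b = 0"
      using R that div_mult_mod_eq[of R ?b] by simp
    then have "\<forall>j\<in>{1..<n}. gcns_b s j * x j = 0" using xs by simp
    then show ?thesis using gcns_b_pos[of _ s] by fastforce
  qed
  have ys: "(\<Sum>i=1..<n. gcns_b s i * y i) = R mod ?b"
    unfolding xs[symmetric] by (intro sum.cong) (auto simp: y_def)
  show ?case
  proof (intro exI[of _ y] conjI)
    show "\<forall>i. i \<notin> {1..<Suc n} \<longrightarrow> y i = 0" using x0 Suc.hyps by (auto simp: y_def)
    show "(\<Sum>i=1..<Suc n. gcns_b s i * y i) = R"
      using Suc.hyps ys by (simp add: y_def)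
    show "\<forall>i\<in>{1..<Suc n}. y i \<le> s i" using xle yle by (auto simp: y_def)
    show "\<forall>i\<in>{1..<Suc n}. y i = s i \<longrightarrow> (\<forall>j\<in>{1..<i}. y j = 0)"
      using xg yz by (auto simp: y_def less_Suc_eq)
  qed
qed

lemma greedy_partial_unique:
  assumes "1 \<le> n"
    and "\<forall>i\<in>{1..<n}. x i \<le> s i"
    and "\<forall>i\<in>{1..<n}. x i = s i \<longrightarrow> (\<forall>j\<in>{1..<i}. x j = 0)"
    and "\<forall>i\<in>{1..<n}. y i \<le> s i"
    and "\<forall>i\<in>{1..<n}. y i = s i \<longrightarrow> (\<forall>j\<in>{1..<i}. y j = 0)"
    and "(\<Sum>i=1..<n. gcns_b s i * x i) = (\<Sum>i=1..<n. gcns_b s i * y i)"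
  shows "\<forall>i\<in>{1..<n}. x i = y i"
  using assms
proof (induction n rule: nat_induct_at_least)
  case base
  then show ?case by simp
next
  case (Suc n)
  let ?X = "\<Sum>i=1..<n. gcns_b s i * x i" and ?Y = "\<Sum>i=1..<n. gcns_b s i * y i"
  have sub: "{1..<n} \<subseteq> {1..<Suc n}" by auto
  have X: "?X < gcns_b s n"
    using Suc.hyps Suc.prems(1,2) sub by (intro greedy_partial_sum_less) blast+
  have Y: "?Y < gcns_b s n"
    using Suc.hyps Suc.prems(3,4) sub by (intro greedy_partial_sum_less) blast+
  have eq: "?X + gcns_b s n * x n = ?Y + gcns_b s n * y n"
    using Suc.hyps Suc.prems(5) by (simp add: add.commute)
  have "x n = (?X + gcns_b s n * x n) div gcns_b s n" using X by simp
  also have "\<dots> = (?Y + gcns_b s n * y n) div gcns_b s n" by (simp only: eq)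
  also have "\<dots> = y n" using Y by simp
  finally have n: "x n = y n" .
  then have XY: "?X = ?Y" using eq by simp
  have "\<forall>i\<in>{1..<n}. x i = y i"
    using Suc.prems(1-4) sub by (intro Suc.IH XY) blast+
  then show ?case using n by (auto simp: less_Suc_eq)
qed

lemma ex1_greedy_presentation:
  assumes "1 \<le> k"
  shows "\<exists>!x. is_greedy_presentation s k M x"
proof -
  let ?b = "gcns_b s k"
  have split: "(\<Sum>i=1..k. gcns_b s i * x i) = (\<Sum>i=1..<k. gcns_b s i * x i) + ?b * x k" for x
    using assms by (simp add: sum.last_plus)
  have iv: "{1..k - 1} = {1..<k}" using assms by auto
  have cond: "(\<forall>i\<in>{2..k - 1}. x i = s i \<longrightarrow> (\<forall>j\<in>{1..<i}. x j = 0)) \<longleftrightarrow>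
      (\<forall>i\<in>{1..<k}. x i = s i \<longrightarrow> (\<forall>j\<in>{1..<i}. x j = 0))" for x :: "nat \<Rightarrow> nat"
  proof
    assume *: "\<forall>i\<in>{2..k - 1}. x i = s i \<longrightarrow> (\<forall>j\<in>{1..<i}. x j = 0)"
    show "\<forall>i\<in>{1..<k}. x i = s i \<longrightarrow> (\<forall>j\<in>{1..<i}. x j = 0)"
    proof (intro ballI impI)
      fix i j assume i: "i \<in> {1..<k}" "x i = s i" and j: "j \<in> {1..<i}"
      then have "i \<in> {2..k - 1}" by auto
      then show "x j = 0" using * i(2) j by blast
    qed
  next
    have "{2..k - 1} \<subseteq> {1..<k}" by auto
    then show "\<forall>i\<in>{2..k - 1}. x i = s i \<longrightarrow> (\<forall>j\<in>{1..<i}. x j = 0)"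
      if "\<forall>i\<in>{1..<k}. x i = s i \<longrightarrow> (\<forall>j\<in>{1..<i}. x j = 0)"
      using that by blast
  qed
  show ?thesis
  proof (rule ex_ex1I)
    have bpos: "0 < ?b" using gcns_b_pos assms by blast
    obtain x where x0: "\<forall>i. i \<notin> {1..<k} \<longrightarrow> x i = 0"
      and xs: "(\<Sum>i=1..<k. gcns_b s i * x i) = M mod ?b"
      and xle: "\<forall>i\<in>{1..<k}. x i \<le> s i"
      and xg: "\<forall>i\<in>{1..<k}. x i = s i \<longrightarrow> (\<forall>j\<in>{1..<i}. x j = 0)"
      using greedy_partial_exists[of k "M mod ?b" s] bpos assms by auto
    define y where "y = x(k := M div ?b)"
    have ys: "(\<Sum>i=1..<k. gcns_b s i * y i) = M mod ?b"
      unfolding xs[symmetric] by (intro sum.cong) (auto simp: y_def)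
    have yk: "y k = M div ?b" by (simp add: y_def)
    have y0: "\<forall>i. i \<notin> {1..k} \<longrightarrow> y i = 0"
    proof (intro allI impI)
      fix i assume "i \<notin> {1..k}"
      then have "i \<notin> {1..<k}" "i \<noteq> k" using assms by auto
      then show "y i = 0" using x0 unfolding y_def by simp
    qed
    have yM: "M mod ?b + ?b * y k = M" by (simp add: yk)
    have yc: "\<forall>i\<in>{1..<k}. y i \<le> s i" using xle by (simp add: y_def)
    have yg: "\<forall>i\<in>{1..<k}. y i = s i \<longrightarrow> (\<forall>j\<in>{1..<i}. y j = 0)"
      using xg by (simp add: y_def)
    show "\<exists>x. is_greedy_presentation s k M x"
      by (rule exI[of _ y], unfold is_greedy_presentation_def split cond iv ys)
        (intro conjI y0 yM yk yc yg)
  next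
    fix x y
    assume x: "is_greedy_presentation s k M x" and y: "is_greedy_presentation s k M y"
    note defs = is_greedy_presentation_def split cond iv
    have x0: "\<forall>i. i \<notin> {1..k} \<longrightarrow> x i = 0"
      and xs: "(\<Sum>i=1..<k. gcns_b s i * x i) + ?b * x k = M"
      and xk: "x k = M div ?b"
      and xc: "\<forall>i\<in>{1..<k}. x i \<le> s i"
        "\<forall>i\<in>{1..<k}. x i = s i \<longrightarrow> (\<forall>j\<in>{1..<i}. x j = 0)"
      using x unfolding defs by blast+
    have y0: "\<forall>i. i \<notin> {1..k} \<longrightarrow> y i = 0"
      and ys: "(\<Sum>i=1..<k. gcns_b s i * y i) + ?b * y k = M"
      and yk: "y k = M div ?b"
      and yc: "\<forall>i\<in>{1..<k}. y i \<le> s i"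
        "\<forall>i\<in>{1..<k}. y i = s i \<longrightarrow> (\<forall>j\<in>{1..<i}. y j = 0)"
      using y unfolding defs by blast+
    have k: "x k = y k" using xk yk by (rule trans[OF _ sym])
    have "(\<Sum>i=1..<k. gcns_b s i * x i) = (\<Sum>i=1..<k. gcns_b s i * y i)"
      using xs ys unfolding k by linarith
    then have lt: "\<forall>i\<in>{1..<k}. x i = y i"
      by (rule greedy_partial_unique[OF assms xc yc])
    have "x i = y i" for i
    proof -
      consider "i \<in> {1..<k}" | "i = k" | "i \<notin> {1..k}"
        unfolding atLeastLessThan_iff atLeastAtMost_iff by linarith
      then show ?thesis
      proof cases
        case 1
        then show ?thesis using lt by blast
      next
        case 2
        then show ?thesis using k by simp
      next
        case 3
        then show ?thesis using x0 y0 by simp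
      qed
    qed
    then show "x = y" by blast
  qed
qed

end

theory Submission
  imports Defs
begin

text \<open>
  Put \<open>w = u a + d\<close>. The generators are \<open>a\<close> and \<open>b\<^sub>i w + a\<close>, so the semigroup consists of the
  numbers \<open>M w + a t\<close> where \<open>M\<close> can be paid with at most \<open>t\<close> coins \<open>b\<^sub>1, \<dots>, b\<^sub>k\<close>. The greedy
  presentation uses the fewest coins, say \<open>f M\<close>, and \<open>f M\<close> exceeds \<open>M div b\<^sub>k\<close> by at most
  \<open>1 + \<Sum> (s\<^sub>i - 1)\<close>, which is at most \<open>w\<close> by hypothesis. Hence replacing \<open>M\<close> by \<open>M mod a\<close> never
  costs more than it saves, and the least element in the class of \<open>r w\<close> modulo \<open>a\<close> is
  \<open>r w + a f r\<close> for \<open>r < a\<close>. Dividing by \<open>p\<close> leaves \<open>r w + (a/p) f (r p)\<close> for \<open>r < a/p\<close>, and the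
  genus is the sum of the quotients of these numbers by \<open>a/p\<close>.
\<close>

section \<open>Greedy presentations and their coin count\<close>

definition greedy_size :: "(nat \<Rightarrow> nat) \<Rightarrow> nat \<Rightarrow> nat \<Rightarrow> nat" where
  "greedy_size s k M = (\<Sum>i=1..k. greedy_presentation s k M i)"

lemma is_greedy_presentation_greedy_presentation:
  "1 \<le> k \<Longrightarrow> is_greedy_presentation s k M (greedy_presentation s k M)"
  unfolding greedy_presentation_def by (rule theI'[OF ex1_greedy_presentation])

lemma greedy_presentation_eqI:
  "1 \<le> k \<Longrightarrow> is_greedy_presentation s k M x \<Longrightarrow> greedy_presentation s k M = x"
  using ex1_greedy_presentation is_greedy_presentation_greedy_presentation by blast

text \<open>Nothing constrains \<open>s\<close> from index \<open>k\<close> on, so positivity is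
  asked for only below \<open>j\<close>.\<close>

lemma gcns_b_mono:
  assumes "1 \<le> i" "i \<le> j" "\<And>l. 1 \<le> l \<Longrightarrow> l < j \<Longrightarrow> 1 \<le> s l"
  shows "gcns_b s i \<le> gcns_b s j"
  using assms(2,1,3)
proof (induction j rule: dec_induct)
  case (step j)
  then have "gcns_b s i \<le> gcns_b s j" "1 \<le> s j" by simp_all
  then have "gcns_b s i \<le> s j * gcns_b s j"
    by (metis le_trans mult_le_mono1 nat_mult_1)
  then show ?case using step by (simp add: gcns_b_Suc)
qed simp

section \<open>Optimality of the greedy presentation by exchange\<close>

lemma sum_mult_delta:
  fixes g :: "nat \<Rightarrow> nat"
  assumes "i \<in> A" "finite A"
  shows "(\<Sum>m\<in>A. g m * (if m = i then c else 0)) = g i * c"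
  using assms by (simp add: if_distrib cong: if_cong)

text \<open>For \<sigma> at least 2, the square of \<sigma> is at least \<sigma> + 1, so the new
  large coin alone outweighs everything removed. For \<sigma> = 1 that estimate fails and the term
  with \<open>e'\<close> is needed. In the application \<open>c\<close>, \<open>e\<close>,
  \<open>e'\<close> are the coins of index i, j, j - 1, and \<sigma>, \<tau> are the entries of
  \<open>s\<close> at i and j - 1.\<close>

lemma exchange_quadratic_gain:
  fixes \<sigma> \<tau> c e e' :: nat
  assumes "1 \<le> \<sigma>" "e \<le> c" "\<tau> \<le> \<sigma>" "e = \<tau> * e' + 1"
  shows "\<sigma> * c\<^sup>2 + e\<^sup>2 < (\<sigma> * c + 1)\<^sup>2 + \<tau> * e'\<^sup>2"
proof (cases "\<sigma> = 1")
  case True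
  show ?thesis
  proof (cases "\<tau> = 0")
    case True
    then show ?thesis using assms \<open>\<sigma> = 1\<close> by (simp add: power2_eq_square)
  next
    case False
    then have "\<tau> = 1" using assms(3) True by simp
    moreover from this have "e = e' + 1" "e' + 1 \<le> c" using assms by simp_all
    ultimately show ?thesis using True by (simp add: power2_eq_square)
  qed
next
  case False
  then have "2 \<le> \<sigma>" using assms(1) by simp
  then have "2 * \<sigma> \<le> \<sigma> * \<sigma>" by (rule mult_le_mono1)
  then have "\<sigma> + 1 \<le> \<sigma>\<^sup>2" using \<open>2 \<le> \<sigma>\<close> unfolding power2_eq_square by linarith
  then have "(\<sigma> + 1) * c\<^sup>2 \<le> \<sigma>\<^sup>2 * c\<^sup>2" by (rule mult_le_mono1)
  moreover have "e\<^sup>2 \<le> c\<^sup>2" using assms(2) by (rule power_mono) simp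
  ultimately show ?thesis by (simp add: power2_eq_square algebra_simps)
qed

text \<open>
  Trading \<open>s\<^sub>i\<close> coins \<open>b\<^sub>i\<close> and one coin \<open>b\<^sub>j\<close> for one coin \<open>b\<^bsub>i+1\<^esub>\<close> and \<open>s\<^bsub>j-1\<^esub>\<close> coins
  \<open>b\<^bsub>j-1\<^esub>\<close> preserves the value, does not increase the number of coins, and increases
  \<open>\<Sum> b\<^sub>i\<^sup>2 x\<^sub>i\<close>.
\<close>

lemma presentation_exchange:
  assumes "1 \<le> j" "j \<le> i" "i < k"
    and s_pos: "\<And>l. 1 \<le> l \<Longrightarrow> l < k \<Longrightarrow> 1 \<le> s l"
    and s_mono: "\<And>l m. 1 \<le> l \<Longrightarrow> l \<le> m \<Longrightarrow> m < k \<Longrightarrow> s l \<le> s m"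
    and enough: "(if i = j then s i + 1 else s i) \<le> x i" "1 \<le> x j"
  shows "\<exists>y. (\<Sum>m=1..k. gcns_b s m * y m) = (\<Sum>m=1..k. gcns_b s m * x m) \<and>
    (\<Sum>m=1..k. y m) \<le> (\<Sum>m=1..k. x m) \<and>
    (\<Sum>m=1..k. (gcns_b s m)\<^sup>2 * x m) < (\<Sum>m=1..k. (gcns_b s m)\<^sup>2 * y m)"
proof -
  \<comment> \<open>The coin \<open>b_1\<close> has no predecessor. With \<open>t = 0\<close> and
    the dummy index 1, the relation \<open>b_j = t * b_j' + 1\<close> holds for j = 1 as
    well.\<close>
  define t where "t = (if j = 1 then 0 else s (j - 1))"
  define j' where "j' = (if j = 1 then 1 else j - 1)"
  define \<delta> where "\<delta> l c m = (if m = l then c else 0)" for l c m :: nat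
  \<comment> \<open>By \<open>enough\<close> the subtraction never truncates; for i = j both
    removals hit the same entry, hence the extra 1 demanded there.\<close>
  define z where "z m = x m - \<delta> i (s i) m - \<delta> j 1 m" for m
  define y where "y m = z m + \<delta> (i + 1) 1 m + \<delta> j' t m" for m
  have x: "x m = z m + \<delta> i (s i) m + \<delta> j 1 m" for m
    using enough by (auto simp: z_def \<delta>_def split: if_splits)
  have mem: "i \<in> {1..k}" "j \<in> {1..k}" "i + 1 \<in> {1..k}" "j' \<in> {1..k}"
    using assms(1-3) by (auto simp: j'_def)
  have delta: "(\<Sum>m=1..k. g m * \<delta> l c m) = g l * c" if "l \<in> {1..k}" for g l c
    unfolding \<delta>_def using that by (intro sum_mult_delta) auto
  have sum_x: "(\<Sum>m=1..k. g m * x m) = (\<Sum>m=1..k. g m * z m) + g i * s i + g j" for g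
    by (simp only: x distrib_left sum.distrib delta[OF mem(1)] delta[OF mem(2)] mult_1_right)
  have sum_y: "(\<Sum>m=1..k. g m * y m) = (\<Sum>m=1..k. g m * z m) + g (i + 1) + g j' * t" for g
    by (simp only: y_def distrib_left sum.distrib delta[OF mem(3)] delta[OF mem(4)] mult_1_right)
  have bi: "gcns_b s (i + 1) = s i * gcns_b s i + 1"
    using assms(1,2) by (simp add: gcns_b_Suc)
  have bj: "gcns_b s j = t * gcns_b s j' + 1"
    using gcns_b_Suc[of "j - 1" s] assms(1) by (auto simp: t_def j'_def)
  have t: "t \<le> s i" using assms(1-3) by (auto simp: t_def intro: s_mono)
  have bji: "gcns_b s j \<le> gcns_b s i" using assms(1-3) s_pos by (intro gcns_b_mono) auto
  have "(gcns_b s i)\<^sup>2 * s i + (gcns_b s j)\<^sup>2 < (gcns_b s (i + 1))\<^sup>2 + (gcns_b s j')\<^sup>2 * t"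
    using exchange_quadratic_gain[OF s_pos bji t bj] assms(1-3)
    by (simp only: bi mult.commute le_trans)
  then have "(\<Sum>m=1..k. (gcns_b s m)\<^sup>2 * x m) < (\<Sum>m=1..k. (gcns_b s m)\<^sup>2 * y m)"
    unfolding sum_x sum_y by linarith
  moreover have "(\<Sum>m=1..k. y m) \<le> (\<Sum>m=1..k. x m)"
    using sum_x[of "\<lambda>_. 1"] sum_y[of "\<lambda>_. 1"] t by simp
  moreover have "(\<Sum>m=1..k. gcns_b s m * y m) = (\<Sum>m=1..k. gcns_b s m * x m)"
    unfolding sum_x sum_y bi bj by (simp add: mult.commute)
  ultimately show ?thesis by blast
qed

text \<open>The digits below \<open>k\<close> contribute less than \<open>b_k\<close>, so the floor
  condition on \<open>x k\<close> is a consequence of the digit conditions.\<close>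

lemma is_greedy_presentationI:
  assumes "1 \<le> k" "\<forall>i. i \<notin> {1..k} \<longrightarrow> x i = 0"
    and xM: "(\<Sum>i=1..k. gcns_b s i * x i) = M"
    and x_le: "\<forall>i\<in>{1..<k}. x i \<le> s i"
    and x_top: "\<forall>i\<in>{1..<k}. x i = s i \<longrightarrow> (\<forall>j\<in>{1..<i}. x j = 0)"
  shows "is_greedy_presentation s k M x"
proof -
  have "(\<Sum>i=1..<k. gcns_b s i * x i) < gcns_b s k"
    by (rule greedy_partial_sum_less[OF assms(1) x_le x_top])
  moreover have "M = (\<Sum>i=1..<k. gcns_b s i * x i) + gcns_b s k * x k"
    using assms(1) xM by (simp add: sum.last_plus)
  ultimately have xk: "x k = M div gcns_b s k" by simp
  have sub: "{1..k - 1} \<subseteq> {1..<k}" "{2..k - 1} \<subseteq> {1..<k}" using assms(1) by auto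
  show ?thesis unfolding is_greedy_presentation_def
    using sub x_le x_top by (intro conjI assms(2) xM xk) blast+
qed

text \<open>Among the tuples of the same value with no more coins, one that maximizes the weighted
  sum \<open>?Q\<close> admits no exchange. Being stuck for i = j bounds every digit below
  \<open>k\<close> by \<open>s\<close>; being stuck for j < i forces zeros below a full digit. By
  uniqueness this tuple is the greedy presentation.\<close>

lemma greedy_size_le:
  assumes "1 \<le> k"
    and s_pos: "\<And>l. 1 \<le> l \<Longrightarrow> l < k \<Longrightarrow> 1 \<le> s l"
    and s_mono: "\<And>l m. 1 \<le> l \<Longrightarrow> l \<le> m \<Longrightarrow> m < k \<Longrightarrow> s l \<le> s m"
  shows "greedy_size s k (\<Sum>i=1..k. gcns_b s i * x i) \<le> (\<Sum>i=1..k. x i)"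
proof -
  let ?M = "\<Sum>i=1..k. gcns_b s i * x i"
  let ?P = "\<lambda>y. (\<Sum>i=1..k. gcns_b s i * y i) = ?M \<and> (\<Sum>i=1..k. y i) \<le> (\<Sum>i=1..k. x i)"
  let ?Q = "\<lambda>y. \<Sum>i=1..k. (gcns_b s i)\<^sup>2 * y i"
  \<comment> \<open>A maximum of \<open>?Q\<close> exists because \<open>?Q\<close> is bounded on
    all competitors.\<close>
  have Q_le: "?Q y \<le> gcns_b s k * ?M" if "?P y" for y
  proof -
    have "(gcns_b s i)\<^sup>2 * y i \<le> gcns_b s k * (gcns_b s i * y i)" if "i \<in> {1..k}" for i
      using gcns_b_mono[of i k s] that s_pos by (simp add: power2_eq_square mult.assoc)
    then have "?Q y \<le> (\<Sum>i=1..k. gcns_b s k * (gcns_b s i * y i))" by (rule sum_mono)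
    also have "\<dots> = gcns_b s k * ?M" using that by (simp only: sum_distrib_left[symmetric])
    finally show ?thesis .
  qed
  obtain y where y: "?P y" and max: "\<And>z. ?P z \<Longrightarrow> ?Q z \<le> ?Q y"
    using ex_has_greatest_nat[of ?P x ?Q "gcns_b s k * ?M + 1"] Q_le by (auto simp: less_Suc_eq_le)
  have stuck: False
    if ij: "1 \<le> j" "j \<le> i" "i < k" "(if i = j then s i + 1 else s i) \<le> y i" "1 \<le> y j" for i j
  proof -
    obtain z where "(\<Sum>i=1..k. gcns_b s i * z i) = (\<Sum>i=1..k. gcns_b s i * y i)"
      and "(\<Sum>i=1..k. z i) \<le> (\<Sum>i=1..k. y i)" and "?Q y < ?Q z"
      using presentation_exchange[of j i k s y, OF ij(1-3) s_pos s_mono ij(4,5)] by blast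
    then show False using max[of z] y by auto
  qed
  \<comment> \<open>The maximizer is arbitrary outside \<open>{1..k}\<close>, while the encoding of
    presentations demands zeros there.\<close>
  define y' where "y' i = (if i \<in> {1..k} then y i else 0)" for i
  have "is_greedy_presentation s k ?M y'"
  proof (rule is_greedy_presentationI[OF assms(1)])
    show "\<forall>i. i \<notin> {1..k} \<longrightarrow> y' i = 0" by (simp add: y'_def)
    show "(\<Sum>i=1..k. gcns_b s i * y' i) = ?M"
      unfolding conjunct1[OF y, symmetric] by (intro sum.cong) (auto simp: y'_def)
    show "\<forall>i\<in>{1..<k}. y' i \<le> s i"
      using stuck[of i i for i] by (force simp: y'_def)
    show "\<forall>i\<in>{1..<k}. y' i = s i \<longrightarrow> (\<forall>j\<in>{1..<i}. y' j = 0)"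
    proof (intro ballI impI)
      fix i j assume "i \<in> {1..<k}" "y' i = s i" "j \<in> {1..<i}"
      then show "y' j = 0" using stuck[of j i] by (cases "y j") (auto simp: y'_def)
    qed
  qed
  then have "greedy_size s k ?M = (\<Sum>i=1..k. y' i)"
    using assms(1) by (simp add: greedy_size_def greedy_presentation_eqI)
  also have "\<dots> = (\<Sum>i=1..k. y i)" by (intro sum.cong) (auto simp: y'_def)
  finally show ?thesis using y by simp
qed

section \<open>Bounds on the coin count\<close>

text \<open>Every entry of \<open>s\<close> in range is positive, so two full digits cannot coexist:
  the upper one would force the lower one to be 0. All digits but one therefore stay at or below
  \<open>s i - 1\<close>, and the exception adds 1.\<close>

lemma greedy_partial_size_le:
  fixes s x :: "nat \<Rightarrow> nat"
  assumes "1 \<le> n"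
    and "\<forall>i\<in>{1..<n}. 1 \<le> s i"
    and "\<forall>i\<in>{1..<n}. x i \<le> s i"
    and "\<forall>i\<in>{1..<n}. x i = s i \<longrightarrow> (\<forall>j\<in>{1..<i}. x j = 0)"
  shows "(\<Sum>i=1..<n. x i) \<le> (\<Sum>i=1..<n. s i - 1) + 1"
  using assms
proof (induction n rule: nat_induct_at_least)
  case base
  then show ?case by simp
next
  case (Suc n)
  have IH: "(\<Sum>i=1..<n. x i) \<le> (\<Sum>i=1..<n. s i - 1) + 1" using Suc.prems by (intro Suc.IH) auto
  have n: "x n \<le> s n" "1 \<le> s n" using Suc.hyps Suc.prems(1,2) by simp_all
  show ?case
  proof (cases "x n = s n")
    case True
    then have "(\<Sum>i=1..<n. x i) = 0" using Suc.prems(3) Suc.hyps by auto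
    then show ?thesis using True n Suc.hyps by simp
  next
    case False
    then show ?thesis using IH n Suc.hyps by simp
  qed
qed

lemma greedy_size_bounds:
  assumes "1 \<le> k" and s_pos: "\<And>l. 1 \<le> l \<Longrightarrow> l < k \<Longrightarrow> 1 \<le> s l"
  shows "M div gcns_b s k \<le> greedy_size s k M"
    and "greedy_size s k M \<le> M div gcns_b s k + (\<Sum>i=1..<k. s i - 1) + 1"
proof -
  let ?x = "greedy_presentation s k M"
  have x: "is_greedy_presentation s k M ?x"
    by (rule is_greedy_presentation_greedy_presentation[OF assms(1)])
  have size: "greedy_size s k M = (\<Sum>i=1..<k. ?x i) + M div gcns_b s k"
    using x assms(1) by (simp add: greedy_size_def is_greedy_presentation_def sum.last_plus)
  then show "M div gcns_b s k \<le> greedy_size s k M" by simp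
  have "(\<Sum>i=1..<k. ?x i) \<le> (\<Sum>i=1..<k. s i - 1) + 1"
  proof (rule greedy_partial_size_le[OF assms(1)])
    show "\<forall>i\<in>{1..<k}. 1 \<le> s i" using s_pos by simp
    show "\<forall>i\<in>{1..<k}. ?x i \<le> s i" using x by (auto simp: is_greedy_presentation_def)
    show "\<forall>i\<in>{1..<k}. ?x i = s i \<longrightarrow> (\<forall>j\<in>{1..<i}. ?x j = 0)"
    proof (intro ballI impI)
      fix i j assume "i \<in> {1..<k}" "?x i = s i" and j: "j \<in> {1..<i}"
      \<comment> \<open>The case i = 1 cannot occur, since j lies strictly between 0 and i.\<close>
      then have "i \<in> {2..k - 1}" by auto
      then show "?x j = 0" using x \<open>?x i = s i\<close> j unfolding is_greedy_presentation_def by blast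
    qed
  qed
  then show "greedy_size s k M \<le> M div gcns_b s k + (\<Sum>i=1..<k. s i - 1) + 1"
    using size by simp
qed

lemma greedy_size_0: "1 \<le> k \<Longrightarrow> greedy_size s k 0 = 0"
proof -
  assume k: "1 \<le> k"
  have "(\<Sum>i=1..k. gcns_b s i * greedy_presentation s k 0 i) = 0"
    using is_greedy_presentation_greedy_presentation[OF k, of s 0]
    by (simp add: is_greedy_presentation_def)
  then show ?thesis using gcns_b_pos[of _ s] by (fastforce simp: greedy_size_def)
qed

section \<open>Floor sums and the genus from least residues\<close>

lemma inj_on_mult_mod:
  fixes W m :: nat
  assumes "coprime W m"
  shows "inj_on (\<lambda>r. r * W mod m) {..<m}"
proof (rule linorder_inj_onI)
  fix r t assume "r < t" "r \<in> {..<m}" "t \<in> {..<m}"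
  show "r * W mod m \<noteq> t * W mod m"
  proof
    assume "r * W mod m = t * W mod m"
    then have "m dvd t * W - r * W" using mod_eq_dvd_iff_nat[of "r * W" "t * W" m] \<open>r < t\<close> by simp
    then have "m dvd (t - r) * W" by (simp add: diff_mult_distrib)
    then have "m dvd t - r" using assms by (simp add: coprime_commute coprime_dvd_mult_left_iff)
    then show False using \<open>r < t\<close> \<open>t \<in> {..<m}\<close> by (auto dest: dvd_imp_le)
  qed
qed auto

text \<open>Pair r with m - r: the two fractions add up to W and neither is an integer, so their
  floors add up to W - 1.\<close>

lemma sum_floor_coprime:
  fixes W m :: nat
  assumes "coprime W m" "0 < m" "0 < W"
  shows "2 * (\<Sum>r=1..m - 1. r * W div m) = (W - 1) * (m - 1)"
proof -
  have pair: "r * W div m + (m - r) * W div m = W - 1" if r: "r \<in> {1..m - 1}" for r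
  proof -
    have "\<not> m dvd r" using r by (auto dest: dvd_imp_le)
    then have "\<not> m dvd r * W" using assms(1) by (simp add: coprime_commute coprime_dvd_mult_left_iff)
    then have pos: "0 < r * W mod m" by (simp add: mod_greater_zero_iff_not_dvd)
    let ?q = "r * W div m" and ?t = "r * W mod m"
    have "r * W < m * W" using r assms(3) by auto
    then have qW: "?q < W" using less_mult_imp_div_less by (simp add: mult.commute)
    have t: "?t < m" using assms(2) by simp
    \<comment> \<open>Division with remainder of the partner: its remainder \<open>m - ?t\<close>
      lies strictly between 0 and m because \<open>?t\<close> is positive.\<close>
    have "(m - r) * W = m * W - (?q * m + ?t)" by (simp add: diff_mult_distrib)
    also have "\<dots> = (W - 1 - ?q) * m + (m - ?t)"
    proof -
      obtain e where e: "W = ?q + 1 + e" using less_imp_Suc_add[OF qW] by auto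
      have e': "W - 1 - ?q = e" using e by linarith
      have "m * W = ?q * m + (e * m + m)" by (subst e) (simp add: algebra_simps)
      moreover have "A + B - (A + C) = B - C" for A B C :: nat by simp
      ultimately show ?thesis unfolding e' using t by (metis Nat.add_diff_assoc less_imp_le)
    qed
    finally have "(m - r) * W div m = W - 1 - ?q"
      using pos t by (metis assms(2) diff_less div_less div_mult_self3 add_0_right less_numeral_extra(3))
    then show ?thesis using qW by simp
  qed
  have "(\<Sum>r=1..m - 1. r * W div m) = (\<Sum>r=1..m - 1. (m - r) * W div m)"
    by (rule sum.reindex_bij_witness[of _ "\<lambda>r. m - r" "\<lambda>r. m - r"]) auto
  then have "2 * (\<Sum>r=1..m - 1. r * W div m) =
      (\<Sum>r=1..m - 1. r * W div m + (m - r) * W div m)"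
    by (simp only: sum.distrib mult_2)
  also have "\<dots> = (\<Sum>r=1..m - 1. W - 1)" using pair by (intro sum.cong) auto
  finally show ?thesis by (simp add: mult.commute)
qed

text \<open>A form of Selmer's formula. The class of \<open>r * W\<close> has least element
  \<open>r * W + m * F r\<close> in \<open>S\<close>, and below it lie as many members of the class
  as the quotient of that number by \<open>m\<close>. Coprimality makes these classes exhaust all
  residues without repetition.\<close>

lemma genus_from_apery:
  fixes W m :: nat and F :: "nat \<Rightarrow> nat"
  assumes cop: "coprime W m" and m: "0 < m" and F0: "F 0 = 0"
    and S: "\<And>x. x \<in> S \<longleftrightarrow> (\<exists>r<m. \<exists>c. x = r * W + m * (F r + c))"
  shows "genus S = (\<Sum>r=1..m - 1. F r) + (\<Sum>r=1..m - 1. r * W div m)"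
proof -
  let ?\<rho> = "\<lambda>r. r * W mod m"
  \<comment> \<open>These are the gaps in the class of \<open>r * W\<close>, listed by their
    quotient modulo \<open>m\<close>.\<close>
  define G where "G r = (\<lambda>q. q * m + ?\<rho> r) ` {..<r * W div m + F r}" for r
  note inj = inj_on_mult_mod[OF cop]
  have surj: "?\<rho> ` {..<m} = {..<m}" using m by (intro endo_inj_surj inj) auto
  have G_iff: "q * m + ?\<rho> r \<in> G r \<longleftrightarrow> q < r * W div m + F r" for q r
    using m by (auto simp: G_def)
  have S_iff: "q * m + ?\<rho> r \<in> S \<longleftrightarrow> r * W div m + F r \<le> q" if r: "r < m" for q r
  proof
    assume "q * m + ?\<rho> r \<in> S"
    then obtain t c where t: "t < m" and eq: "q * m + ?\<rho> r = t * W + m * (F t + c)"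
      using S by blast
    have "(q * m + ?\<rho> r) mod m = (t * W + m * (F t + c)) mod m" by (simp only: eq)
    then have "?\<rho> r = ?\<rho> t" by simp
    then have "t = r" using inj r t by (auto dest: inj_onD)
    have "(q * m + ?\<rho> r) div m = (t * W + m * (F t + c)) div m" by (simp only: eq)
    then show "r * W div m + F r \<le> q" using m \<open>t = r\<close> by simp
  next
    assume "r * W div m + F r \<le> q"
    then obtain c where "q = r * W div m + F r + c" using le_Suc_ex by blast
    then have "q * m + ?\<rho> r = (r * W div m * m + ?\<rho> r) + m * (F r + c)"
      by (simp only: algebra_simps)
    then have "q * m + ?\<rho> r = r * W + m * (F r + c)" by simp
    then show "q * m + ?\<rho> r \<in> S" using S r by blast
  qed
  \<comment> \<open>Hence the restriction to positive gaps removes nothing.\<close>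
  have "0 \<in> S" using S_iff[of 0 0] m F0 by simp
  have decomp: "\<exists>r<m. n = n div m * m + ?\<rho> r" for n
  proof -
    have "n mod m \<in> ?\<rho> ` {..<m}" using m surj by simp
    then obtain r where "r < m" "n mod m = ?\<rho> r" by auto
    then show ?thesis by (metis div_mult_mod_eq)
  qed
  have "{n. 0 < n \<and> n \<notin> S} = (\<Union>r<m. G r)"
  proof (intro set_eqI iffI)
    fix n assume n: "n \<in> {n. 0 < n \<and> n \<notin> S}"
    obtain r where "r < m" "n = n div m * m + ?\<rho> r" using decomp by blast
    then show "n \<in> (\<Union>r<m. G r)" using n S_iff G_iff by (metis (no_types, lifting) UN_I lessThan_iff linorder_not_less mem_Collect_eq)
  next
    fix n assume "n \<in> (\<Union>r<m. G r)"
    then obtain r q where "r < m" "n = q * m + ?\<rho> r" "q < r * W div m + F r"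
      by (auto simp: G_def)
    then have "n \<notin> S" using S_iff by auto
    then show "n \<in> {n. 0 < n \<and> n \<notin> S}" using \<open>0 \<in> S\<close> by (cases "n = 0") auto
  qed
  then have "genus S = card (\<Union>r<m. G r)" by (simp add: genus_def)
  also have "\<dots> = (\<Sum>r<m. card (G r))"
  proof (rule card_UN_disjoint)
    have res: "n mod m = ?\<rho> r" if "n \<in> G r" for n r using that by (auto simp: G_def)
    show "\<forall>r\<in>{..<m}. \<forall>t\<in>{..<m}. r \<noteq> t \<longrightarrow> G r \<inter> G t = {}"
      using res inj by (metis (no_types, lifting) disjoint_iff inj_onD)
  qed (auto simp: G_def)
  also have "\<dots> = (\<Sum>r<m. r * W div m + F r)"
    using m by (intro sum.cong) (auto simp: G_def card_image inj_on_def)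
  also have "\<dots> = (\<Sum>r\<in>{1..m - 1}. r * W div m + F r)"
    using F0 by (intro sum.mono_neutral_right) (auto simp: Suc_le_eq)
  finally show ?thesis by (simp add: sum.distrib)
qed

section \<open>Least residues of the semigroup and of its quotient\<close>

text \<open>Each generator beyond \<open>a\<close> equals \<open>b_i * (u * a + d) + a\<close>. The
  identity is kept in the integers because \<open>u * a + d\<close> may be negative at this
  point.\<close>

lemma generated_semigroup_gcns_iff:
  "n \<in> generated_semigroup (gcns_tuple a k d u s) \<longleftrightarrow>
    (\<exists>c x. int n = int (\<Sum>i=1..k. gcns_b s i * x i) * (int u * int a + d) +
      int a * int ((\<Sum>i=1..k. x i) + c))"
proof -
  have "(\<Sum>i<length (gcns_tuple a k d u s). int (c i) * gcns_tuple a k d u s ! i) =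
      int (\<Sum>i=1..k. gcns_b s i * c i) * (int u * int a + d) +
      int a * int ((\<Sum>i=1..k. c i) + c 0)" for c
  proof -
    have "(\<Sum>i<length (gcns_tuple a k d u s). int (c i) * gcns_tuple a k d u s ! i) =
        int (c 0) * int a + (\<Sum>i<k. int (c (Suc i)) * gcns_gen a d u s (Suc i))"
      by (simp add: gcns_tuple_def sum.lessThan_Suc_shift del: upt_Suc sum.lessThan_Suc)
    also have "(\<Sum>i<k. int (c (Suc i)) * gcns_gen a d u s (Suc i)) =
        (\<Sum>i=1..k. int (c i) * gcns_gen a d u s i)"
      by (rule sum.reindex_bij_witness[of _ "\<lambda>i. i - 1" Suc]) auto
    also have "\<dots> = (\<Sum>i=1..k. int (gcns_b s i * c i) * (int u * int a + d) + int a * int (c i))"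
      by (intro sum.cong) (auto simp: gcns_gen_def gcns_h_def algebra_simps)
    finally show ?thesis
      by (simp add: sum.distrib sum_distrib_left sum_distrib_right algebra_simps)
  qed
  then have "n \<in> generated_semigroup (gcns_tuple a k d u s) \<longleftrightarrow>
    (\<exists>c. int n = int (\<Sum>i=1..k. gcns_b s i * c i) * (int u * int a + d) +
      int a * int ((\<Sum>i=1..k. c i) + c 0))"
    by (simp add: generated_semigroup_def)
  also have "\<dots> \<longleftrightarrow> (\<exists>c x. int n = int (\<Sum>i=1..k. gcns_b s i * x i) * (int u * int a + d) +
      int a * int ((\<Sum>i=1..k. x i) + c))" (is "?L \<longleftrightarrow> ?R")
  proof
    assume ?R
    then obtain c x where eq: "int n = int (\<Sum>i=1..k. gcns_b s i * x i) * (int u * int a + d) +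
      int a * int ((\<Sum>i=1..k. x i) + c)" by blast
    \<comment> \<open>Index 0 is free in both sums and carries the coefficient of
      \<open>a\<close>.\<close>
    let ?y = "x(0 := c)"
    have "(\<Sum>i=1..k. gcns_b s i * x i) = (\<Sum>i=1..k. gcns_b s i * ?y i)"
      "(\<Sum>i=1..k. x i) = (\<Sum>i=1..k. ?y i)" by (intro sum.cong; auto)+
    then show ?L using eq by (intro exI[of _ ?y]) (simp only: fun_upd_same)
  qed blast
  finally show ?thesis .
qed

lemma generated_semigroup_gcns_apery:
  fixes W :: nat
  assumes a: "0 < a" and k: "1 \<le> k"
    and s_pos: "\<And>l. 1 \<le> l \<Longrightarrow> l < k \<Longrightarrow> 1 \<le> s l"
    and s_mono: "\<And>l m. 1 \<le> l \<Longrightarrow> l \<le> m \<Longrightarrow> m < k \<Longrightarrow> s l \<le> s m"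
    and W: "int W = int u * int a + d" and W_ge: "(\<Sum>i=1..<k. s i - 1) + 1 \<le> W"
  shows "n \<in> generated_semigroup (gcns_tuple a k d u s) \<longleftrightarrow>
    (\<exists>r<a. \<exists>c. n = r * W + a * (greedy_size s k r + c))"
proof -
  have "n \<in> generated_semigroup (gcns_tuple a k d u s) \<longleftrightarrow>
      (\<exists>c x. int n = int ((\<Sum>i=1..k. gcns_b s i * x i) * W + a * ((\<Sum>i=1..k. x i) + c)))"
    unfolding generated_semigroup_gcns_iff W[symmetric] by simp
  also have "\<dots> \<longleftrightarrow>
      (\<exists>c x. n = (\<Sum>i=1..k. gcns_b s i * x i) * W + a * ((\<Sum>i=1..k. x i) + c))"
    by (simp only: of_nat_eq_iff)
  also have "\<dots> \<longleftrightarrow> (\<exists>r<a. \<exists>c. n = r * W + a * (greedy_size s k r + c))" (is "?L \<longleftrightarrow> ?R")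
  proof
    assume ?L
    then obtain c x where n: "n = (\<Sum>i=1..k. gcns_b s i * x i) * W + a * ((\<Sum>i=1..k. x i) + c)"
      by blast
    define M where "M = (\<Sum>i=1..k. gcns_b s i * x i)"
    define r where "r = M mod a"
    define j where "j = M div a"
    have M: "M = r + j * a" by (simp add: r_def j_def)
    have opt: "greedy_size s k M \<le> (\<Sum>i=1..k. x i)"
      unfolding M_def by (rule greedy_size_le[of k s x, OF k s_pos s_mono])
    \<comment> \<open>Passing from M to r releases \<open>j * W\<close> further copies of
      \<open>a\<close>. For positive j this covers the excess of \<open>greedy_size s k r\<close>
      over its quotient by \<open>b_k\<close>, which is at most \<open>W\<close>, and that quotient
      does not exceed the one of M.\<close>
    have "greedy_size s k r \<le> greedy_size s k M + j * W"
    proof (cases "j = 0")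
      case False
      have "greedy_size s k r \<le> r div gcns_b s k + W"
        using greedy_size_bounds(2)[of k s r, OF k s_pos] W_ge by linarith
      also have "r div gcns_b s k \<le> M div gcns_b s k" using M by (intro div_le_mono) simp
      also have "\<dots> \<le> greedy_size s k M" by (rule greedy_size_bounds(1)[of k s M, OF k s_pos])
      also have "W \<le> j * W" using False by simp
      finally show ?thesis by simp
    qed (simp add: M)
    then obtain e where e: "(\<Sum>i=1..k. x i) + j * W = greedy_size s k r + e"
      using opt le_Suc_ex[of "greedy_size s k r" "(\<Sum>i=1..k. x i) + j * W"] by auto
    have "n = r * W + a * ((\<Sum>i=1..k. x i) + j * W + c)"
      unfolding n M_def[symmetric] M by (simp add: algebra_simps)
    also have "\<dots> = r * W + a * (greedy_size s k r + (e + c))" unfolding e by (simp add: add.assoc)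
    finally have "n = r * W + a * (greedy_size s k r + (e + c))" .
    moreover have "r < a" using a by (simp add: r_def)
    ultimately show ?R by blast
  next
    assume ?R
    then obtain r c where n: "n = r * W + a * (greedy_size s k r + c)" by blast
    have "(\<Sum>i=1..k. gcns_b s i * greedy_presentation s k r i) = r"
      using is_greedy_presentation_greedy_presentation[OF k] by (simp add: is_greedy_presentation_def)
    then show ?L using n unfolding greedy_size_def
      by (intro exI[of _ c] exI[of _ "greedy_presentation s k r"]) simp
  qed
  finally show ?thesis .
qed

text \<open>As \<open>p\<close> divides the modulus and is coprime to \<open>W\<close>, an element
  of \<open>S\<close> is a multiple of \<open>p\<close> only if its index r is; then
  \<open>p\<close> cancels throughout.\<close>

lemma quotient_apery:
  fixes W p m :: nat
  assumes "0 < p" "coprime W p"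
    and S: "\<And>n. n \<in> S \<longleftrightarrow> (\<exists>r<p * m. \<exists>c. n = r * W + p * m * (F r + c))"
  shows "x \<in> semigroup_quotient S p \<longleftrightarrow> (\<exists>r<m. \<exists>c. x = r * W + m * (F (r * p) + c))"
proof
  assume "x \<in> semigroup_quotient S p"
  then obtain r c where r: "r < p * m" and eq: "p * x = r * W + p * (m * (F r + c))"
    by (auto simp: semigroup_quotient_def S mult.assoc)
  have "p dvd r * W + p * (m * (F r + c))" unfolding eq[symmetric] by simp
  then have "p dvd r * W" by (metis dvd_add_left_iff dvd_triv_left)
  then have "p dvd r" using assms(2) by (simp add: coprime_commute coprime_dvd_mult_left_iff)
  then obtain t where t: "r = t * p" by (metis dvdE mult.commute)
  have "p * x = p * (t * W + m * (F (t * p) + c))"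
    using eq unfolding t by (simp add: algebra_simps)
  then have "x = t * W + m * (F (t * p) + c)" using assms(1) by simp
  moreover have "t < m" using r t by simp
  ultimately show "\<exists>r<m. \<exists>c. x = r * W + m * (F (r * p) + c)" by blast
next
  assume "\<exists>r<m. \<exists>c. x = r * W + m * (F (r * p) + c)"
  then obtain r c where "r < m" "x = r * W + m * (F (r * p) + c)" by blast
  then have "r * p < p * m" "p * x = r * p * W + p * m * (F (r * p) + c)"
    using assms(1) by (simp_all add: algebra_simps)
  then show "x \<in> semigroup_quotient S p" unfolding semigroup_quotient_def S by blast
qed

theorem theorem3p3:
  fixes a k u p :: nat and d :: int and s :: "nat \<Rightarrow> nat"
  assumes "is_gcns a k d u s"
    and "p > 0" and "p dvd a" and "p \<noteq> a"
    and "int u * int a + d + int k - 2 \<ge> (\<Sum>i=1..k - 1. int (s i))"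
  shows "real (genus (semigroup_quotient (generated_semigroup (gcns_tuple a k d u s)) p)) =
    (\<Sum>r=1..a div p - 1. \<Sum>i=1..k. real (greedy_presentation s k (r * p) i)) +
    (real u * real a + real_of_int d - 1) / 2 * (real a / real p - 1)"
proof -
  have a: "2 \<le> a" and k: "2 \<le> k" and gcd: "gcd (int a) d = 1" and s1: "1 \<le> s 1"
    and s_step: "\<forall>i\<in>{1..<k - 1}. s i \<le> s (i + 1)"
    using assms(1) by (auto simp: is_gcns_def)
  have s_mono: "s l \<le> s m" if "1 \<le> l" "l \<le> m" "m < k" for l m
    using that(2,1,3)
  proof (induction m rule: dec_induct)
    case (step m)
    then have "s l \<le> s m" "m \<in> {1..<k - 1}" by auto
    then show ?case using s_step le_trans by fastforce
  qed simp
  have s_pos: "1 \<le> s l" if "1 \<le> l" "l < k" for l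
    using s1 s_mono[of 1 l] that by simp
  \<comment> \<open>There are k - 1 summands, so the left side is the sum of the \<open>s i\<close>
    minus k plus 2, and the hypothesis says exactly that this is at most
    \<open>u * a + d\<close>.\<close>
  have "int ((\<Sum>i=1..<k. s i - 1) + 1) = (\<Sum>i=1..<k. int (s i) - 1) + 1"
    using s_pos by (simp add: of_nat_diff)
  also have "\<dots> = (\<Sum>i=1..k - 1. int (s i)) - (int k - 1) + 1"
  proof -
    have "{1..k - 1} = {1..<k}" using k by auto
    then show ?thesis using k by (simp add: sum_subtractf of_nat_diff)
  qed
  finally have ge: "int ((\<Sum>i=1..<k. s i - 1) + 1) \<le> int u * int a + d" using assms(5) by linarith
  \<comment> \<open>By \<open>ge\<close> the integer is positive even for negative \<open>d\<close>,
    so \<open>nat\<close> loses nothing.\<close>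
  define W where "W = nat (int u * int a + d)"
  have W: "int W = int u * int a + d" using order_trans[OF of_nat_0_le_iff ge] by (simp add: W_def)
  have W_ge: "(\<Sum>i=1..<k. s i - 1) + 1 \<le> W" using ge unfolding W[symmetric] of_nat_le_iff .
  have "gcd (int a) (int W) = 1" using gcd gcd_add_mult[of "int a" "int u" d] unfolding W by simp
  then have cop: "coprime W a" by (simp add: coprime_iff_gcd_eq_1 gcd.commute)
  obtain m where m: "a = p * m" using assms(3) by blast
  have copp: "coprime W p" "coprime W m" using cop m by simp_all
  have m0: "0 < m" using a m by (cases m) auto
  let ?S = "generated_semigroup (gcns_tuple a k d u s)"
  have S: "n \<in> ?S \<longleftrightarrow> (\<exists>r<p * m. \<exists>c. n = r * W + p * m * (greedy_size s k r + c))" for n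
    using generated_semigroup_gcns_apery[of a k s W u d n, OF _ _ s_pos s_mono W W_ge] a k m0 assms(2) unfolding m by simp
  have "genus (semigroup_quotient ?S p) =
      (\<Sum>r=1..m - 1. greedy_size s k (r * p)) + (\<Sum>r=1..m - 1. r * W div m)"
    by (rule genus_from_apery[OF copp(2) m0 _ quotient_apery[OF assms(2) copp(1) S]])
      (use k greedy_size_0 in simp)
  moreover have "real (\<Sum>r=1..m - 1. r * W div m) = (real W - 1) / 2 * (real m - 1)"
  proof -
    have "real (2 * (\<Sum>r=1..m - 1. r * W div m)) = real ((W - 1) * (m - 1))"
      using sum_floor_coprime[OF copp(2) m0] W_ge by simp
    then show ?thesis using m0 W_ge by (simp add: of_nat_diff)
  qed
  moreover have "real W = real u * real a + real_of_int d"
    using arg_cong[OF W, of real_of_int] by simp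
  moreover have "a div p = m" "real a / real p = real m" using m assms(2) by simp_all
  ultimately show ?thesis by (simp add: greedy_size_def)
qed

end
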